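(* If $T$ is a tree with at least $3$ vertices and $H$ is a connected graph with at least $2$ vertices, then $\mu_{\rm t}(T\,\square\,H)=\mu_{\rm t}(T)\,\mu_{\rm t}(H)$.
   Context: All graphs are finite, simple and connected. The Cartesian product $G\,\square\,H$ has vertex set $V(G)\times V(H)$, with $(g,h)$ adjacent to $(g',h')$ iff either $gg'\in E(G)$ and $h=h'$, or $g=g'$ and $hh'\in E(H)$. For $X\subseteq V(G)$, two vertices $x,y$ are $X$-visible if there is a shortest $x,y$-path $P$ with $V(P)\cap X\subseteq\{x,y\}$; $X$ is a total mutual-visibility set if every pair of vertices of $G$ is $X$-visible. $\mu_{\rm t}(G)$ is the largest cardinality of a total mutual-visibility set of $G$. *)

theory Defs
  imports "Graph_Theory.Graph_Theory"
begin

text \<open>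
  Finite simple graphs are the symmetric, loop-free, finite digraphs without parallel arcs of
  \<^locale>\<open>pair_graph\<close>: an undirected edge is represented by its two arcs.
\<close>

definition cart_prod :: "'a pair_pre_digraph \<Rightarrow> 'b pair_pre_digraph \<Rightarrow> ('a \<times> 'b) pair_pre_digraph"
    (infixr "\<box>" 70) where
  "G \<box> H =
     \<lparr> pverts = pverts G \<times> pverts H,
       parcs = {((g, h), (g', h')) | g h g' h'.
         (g, h) \<in> pverts G \<times> pverts H \<and> (g', h') \<in> pverts G \<times> pverts H \<and>
         ((g, g') \<in> parcs G \<and> h = h' \<or> g = g' \<and> (h, h') \<in> parcs H)} \<rparr>"

text \<open>
  The constants \<^const>\<open>forest\<close> and \<^const>\<open>tree\<close> are not used for trees: they are phrased with
  directed cycles, so every symmetric arc pair \<open>u, v, u\<close> would count as a cycle. Here a cycle is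
  given by its list of at least three distinct vertices, the last being adjacent to the first.
\<close>

definition is_cycle :: "'a pair_pre_digraph \<Rightarrow> 'a vwalk \<Rightarrow> bool" where
  "is_cycle G c \<longleftrightarrow> vpath c (with_proj G) \<and> 3 \<le> length c \<and> (last c, hd c) \<in> parcs G"

definition is_tree :: "'a pair_pre_digraph \<Rightarrow> bool" where
  "is_tree G \<longleftrightarrow> pair_graph G \<and> connected (with_proj G) \<and> (\<nexists>c. is_cycle G c)"

definition path_betw :: "'a pair_pre_digraph \<Rightarrow> 'a \<Rightarrow> 'a vwalk \<Rightarrow> 'a \<Rightarrow> bool" where
  "path_betw G x p y \<longleftrightarrow> vpath p (with_proj G) \<and> hd p = x \<and> last p = y"

definition shortest_path :: "'a pair_pre_digraph \<Rightarrow> 'a \<Rightarrow> 'a vwalk \<Rightarrow> 'a \<Rightarrow> bool" where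
  "shortest_path G x p y \<longleftrightarrow>
     path_betw G x p y \<and> (\<forall>q. path_betw G x q y \<longrightarrow> vwalk_length p \<le> vwalk_length q)"

definition visible :: "'a pair_pre_digraph \<Rightarrow> 'a set \<Rightarrow> 'a \<Rightarrow> 'a \<Rightarrow> bool" where
  "visible G X x y \<longleftrightarrow> (\<exists>p. shortest_path G x p y \<and> set p \<inter> X \<subseteq> {x, y})"

definition total_mutual_visibility_set :: "'a pair_pre_digraph \<Rightarrow> 'a set \<Rightarrow> bool" where
  "total_mutual_visibility_set G X \<longleftrightarrow>
     X \<subseteq> pverts G \<and> (\<forall>x \<in> pverts G. \<forall>y \<in> pverts G. visible G X x y)"

definition mu_t :: "'a pair_pre_digraph \<Rightarrow> nat" where
  "mu_t G = Max (card ` {X. total_mutual_visibility_set G X})"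

text \<open>
  For finite connected graphs, the maximum in \<^const>\<open>mu_t\<close> ranges over a finite nonempty set.
\<close>

lemma finite_total_mutual_visibility_sets:
  "finite (pverts G) \<Longrightarrow> finite {X. total_mutual_visibility_set G X}"
  by (rule finite_subset[of _ "Pow (pverts G)"])
     (auto simp: total_mutual_visibility_set_def)

lemma total_mutual_visibility_set_empty:
  assumes "pair_graph G" "connected (with_proj G)"
  shows "total_mutual_visibility_set G {}"
proof -
  interpret pair_graph G by fact
  have "\<exists>p. shortest_path G x p y" if "x \<in> pverts G" "y \<in> pverts G" for x y
  proof -
    have "x \<rightarrow>\<^sup>*\<^bsub>with_proj (mk_symmetric (with_proj G))\<^esub> y"
      using assms(2) that by (simp add: connected_def strongly_connected_def)
    then have "x \<rightarrow>\<^sup>*\<^bsub>with_proj G\<^esub> y"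
      by (simp add: reachable_mk_symmetric_eq[OF pair_sym_arcs])
    then obtain q where "vpath q (with_proj G)" "hd q = x" "last q = y"
      using reachable_vpath_conv by auto
    then have "path_betw G x q y" by (simp add: path_betw_def)
    then show ?thesis
      unfolding shortest_path_def
      using ex_has_least_nat[of "\<lambda>q. path_betw G x q y" q vwalk_length] by blast
  qed
  then show ?thesis by (auto simp: total_mutual_visibility_set_def visible_def)
qed

lemma pair_graph_cart_prod:
  assumes "pair_graph G" "pair_graph H"
  shows "pair_graph (G \<box> H)"
proof -
  interpret G: pair_graph G by fact
  interpret H: pair_graph H by fact
  have fin: "finite (pverts G \<times> pverts H)" by simp
  have sub: "parcs (G \<box> H) \<subseteq> (pverts G \<times> pverts H) \<times> (pverts G \<times> pverts H)"
    by (auto simp: cart_prod_def)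
  have "finite (parcs (G \<box> H))" using finite_subset[OF sub] fin by blast
  moreover have "symmetric (with_proj (G \<box> H))"
    using G.pair_sym_arcs H.pair_sym_arcs
    by (auto simp: symmetric_def sym_def cart_prod_def)
  ultimately show ?thesis
    by unfold_locales
       (auto simp: cart_prod_def dest: G.pair_no_loops H.pair_no_loops)
qed

end

theory Submission
  imports Defs
begin

text \<open>
  Call a vertex interior if it has two distinct neighbours \<open>u\<close>, \<open>w\<close>. In a tree such a vertex \<open>v\<close> lies
  on the only shortest path from \<open>u\<close> to \<open>w\<close>, and this persists in every layer \<open>T \<times> {h}\<close> of the
  product, so total mutual-visibility sets of \<open>T\<close> and of \<open>T \<box> H\<close> live over the leaves. A shortest
  path between two vertices of a layer \<open>{t} \<times> H\<close> stays in that layer, hence at most \<open>mu_t H\<close>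
  vertices are selected over each leaf. Conversely, for a total mutual-visibility set \<open>S\<close> of \<open>H\<close>, the
  set of leaves times \<open>S\<close> is a total mutual-visibility set: a path in \<open>T\<close> between distinct vertices
  contains an interior vertex, and all the moves in the direction of \<open>H\<close> can be made there.
\<close>

definition interior_verts :: "'a pair_pre_digraph \<Rightarrow> 'a set" where
  "interior_verts G = {v. \<exists>u w. (u, v) \<in> parcs G \<and> (v, w) \<in> parcs G \<and> u \<noteq> w}"

section \<open>Walks and shortest paths\<close>

lemma pair_graph_arc_sym: "pair_graph G \<Longrightarrow> (u, v) \<in> parcs G \<Longrightarrow> (v, u) \<in> parcs G"
  using pair_sym_digraph.pair_sym_arcs[of G]
  by (auto simp: pair_graph_def pair_pseudo_graph_def symmetric_def dest: symD)

text \<open>In terms of \<open>successively\<close>, splitting, gluing and mapping walks reduces to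
  list rules.\<close>

lemma vwalk_conv_successively:
  "vwalk p (with_proj G) \<longleftrightarrow>
     p \<noteq> [] \<and> set p \<subseteq> pverts G \<and> successively (\<lambda>u v. (u, v) \<in> parcs G) p"
proof -
  have "set (vwalk_arcs p) \<subseteq> parcs G \<longleftrightarrow> successively (\<lambda>u v. (u, v) \<in> parcs G) p"
    by (induct p rule: vwalk_arcs.induct) auto
  then show ?thesis by (auto simp: vwalk_def)
qed

lemma length_vwalk_to_vpath:
  assumes "vwalk p G"
  shows "length (vwalk_to_vpath p) \<le> card (set p)"
proof -
  have "length (vwalk_to_vpath p) = card (set (vwalk_to_vpath p))"
    using vwalk_to_vpath_vpath[OF assms] by (auto simp: distinct_card)
  also have "\<dots> \<le> card (set p)"
    by (intro card_mono) (auto dest: vwalk_to_vpath_subset)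
  finally show ?thesis .
qed

text \<open>Loop erasure never lengthens a walk, so minimality among paths and among walks agree,
  and a shortest walk is already a path. Competing walks then need no proof of distinctness.\<close>

lemma shortest_path_iff_vwalk:
  "shortest_path G x p y \<longleftrightarrow>
     vwalk p (with_proj G) \<and> hd p = x \<and> last p = y \<and>
     (\<forall>q. vwalk q (with_proj G) \<and> hd q = x \<and> last q = y \<longrightarrow> length p \<le> length q)"
    (is "?L \<longleftrightarrow> ?R")
proof
  assume L: ?L
  have "length p \<le> length q" if q: "vwalk q (with_proj G)" "hd q = x" "last q = y" for q
  proof -
    have "path_betw G x (vwalk_to_vpath q) y"
      using q vwalk_to_vpath_vpath[of q]
      by (simp add: path_betw_def vwalk_to_vpath_hd vwalk_to_vpath_last)
    then have "length p - 1 \<le> length (vwalk_to_vpath q) - 1"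
      using L by (auto simp: shortest_path_def)
    \<comment> \<open>The subtraction of 1 is truncated; nonemptiness lets it be cancelled.\<close>
    moreover have "vwalk_to_vpath q \<noteq> []"
      using q by (intro vwalk_to_vpath_nonempty) auto
    ultimately have "length p \<le> length (vwalk_to_vpath q)"
      by (cases "vwalk_to_vpath q") auto
    then show ?thesis
      using length_vwalk_to_vpath[OF q(1)] card_length[of q] by linarith
  qed
  then show ?R using L by (auto simp: shortest_path_def path_betw_def vpath_def)
next
  assume R: ?R
  \<comment> \<open>Here \<open>p\<close> competes with its own loop erasure, which forces it to be
    free of repetitions.\<close>
  have "length p \<le> length (vwalk_to_vpath p)"
    using R vwalk_to_vpath_vpath[of p "with_proj G"]
    by (simp add: vpath_def vwalk_to_vpath_hd vwalk_to_vpath_last)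
  also have "\<dots> \<le> card (set p)"
    using R length_vwalk_to_vpath by blast
  finally have "distinct p"
    using card_length[of p] by (intro card_distinct) simp
  then show ?L
    using R by (auto simp: shortest_path_def path_betw_def vpath_def diff_le_mono)
qed

lemma ex_shortest_path:
  assumes "pair_graph G" "connected (with_proj G)" "x \<in> pverts G" "y \<in> pverts G"
  obtains p where "shortest_path G x p y"
  using total_mutual_visibility_set_empty[OF assms(1,2)] assms(3,4)
  by (auto simp: total_mutual_visibility_set_def visible_def)

section \<open>Total mutual-visibility sets and vertices excluded from them\<close>

lemma card_le_mu_t:
  "finite (pverts G) \<Longrightarrow> total_mutual_visibility_set G X \<Longrightarrow> card X \<le> mu_t G"
  unfolding mu_t_def by (intro Max_ge) (auto intro: finite_total_mutual_visibility_sets)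

lemma mu_t_attained:
  assumes "pair_graph G" "connected (with_proj G)"
  obtains X where "total_mutual_visibility_set G X" "card X = mu_t G"
proof -
  interpret pair_graph G by fact
  have "mu_t G \<in> card ` {X. total_mutual_visibility_set G X}"
    unfolding mu_t_def using total_mutual_visibility_set_empty[OF assms(1,2)]
    by (intro Max_in) (auto intro: finite_total_mutual_visibility_sets pair_finite_verts)
  then show ?thesis using that by auto
qed

lemma total_mutual_visibility_setE:
  assumes "total_mutual_visibility_set G X" "x \<in> pverts G" "y \<in> pverts G"
  obtains p where "shortest_path G x p y" "set p \<inter> X \<subseteq> {x, y}"
  using assms unfolding total_mutual_visibility_set_def visible_def by blast

text \<open>The only shortest path from \<open>u\<close> to \<open>w\<close> is
  \<open>[u, v, w]\<close>, so selecting \<open>v\<close> would block that pair. The statement is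
  kept free of trees in order to serve both \<open>T\<close> and \<open>T \<box> H\<close>.\<close>

lemma total_mutual_visibility_set_not_in:
  assumes "pair_graph G" "total_mutual_visibility_set G X"
    and uvw: "(u, v) \<in> parcs G" "(v, w) \<in> parcs G" "u \<noteq> w" "(u, w) \<notin> parcs G"
    and unique: "\<And>z. (u, z) \<in> parcs G \<Longrightarrow> (z, w) \<in> parcs G \<Longrightarrow> z = v"
  shows "v \<notin> X"
proof
  assume "v \<in> X"
  interpret pair_graph G by fact
  have V: "u \<in> pverts G" "v \<in> pverts G" "w \<in> pverts G"
    using uvw in_arcsD1 in_arcsD2 by auto
  obtain p where p: "shortest_path G u p w" "set p \<inter> X \<subseteq> {u, w}"
    using total_mutual_visibility_setE[OF assms(2) V(1,3)] .
  have "vwalk [u, v, w] (with_proj G)"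
    using uvw V by (simp add: vwalk_conv_successively)
  then have "length p \<le> length [u, v, w]"
    using p(1) unfolding shortest_path_iff_vwalk
    by (metis last.simps list.sel(1) list.simps(3))
  moreover have "vwalk p (with_proj G)" "hd p = u" "last p = w"
    using p(1) by (auto simp: shortest_path_iff_vwalk)
  \<comment> \<open>At most three vertices are possible; one is excluded by
    \<open>u \<noteq> w\<close>, two by nonadjacency.\<close>
  ultimately obtain z where "p = [u, z, w]" "(u, z) \<in> parcs G" "(z, w) \<in> parcs G"
    using uvw(3,4)
    by (auto simp: vwalk_conv_successively neq_Nil_conv successively_Cons le_Suc_eq length_Suc_conv)
  then have "v \<in> set p" using unique by auto
  then have "v = u \<or> v = w" using p(2) \<open>v \<in> X\<close> by auto
  then show False using uvw(1,2) pair_no_loops by fastforce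
qed

text \<open>An edge from \<open>u\<close> to \<open>w\<close> would close a triangle, and a second
  common neighbour a 4-cycle.\<close>

lemma is_tree_path_two:
  assumes "is_tree T" and uvw: "(u, v) \<in> parcs T" "(v, w) \<in> parcs T" "u \<noteq> w"
  shows "(u, w) \<notin> parcs T"
    and "(u, z) \<in> parcs T \<Longrightarrow> (z, w) \<in> parcs T \<Longrightarrow> z = v"
proof -
  have "pair_graph T" and acyclic: "\<nexists>c. is_cycle T c"
    using assms(1) by (auto simp: is_tree_def)
  interpret pair_graph T by fact
  have V: "u \<in> pverts T" "v \<in> pverts T" "w \<in> pverts T"
    using uvw in_arcsD1 in_arcsD2 by auto
  have sym: "(y, x) \<in> parcs T" if "(x, y) \<in> parcs T" for x y
    using pair_graph_arc_sym[OF \<open>pair_graph T\<close> that] .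
  have neq: "u \<noteq> v" "v \<noteq> w" using uvw pair_no_loops by fastforce+
  show "(u, w) \<notin> parcs T"
  proof
    assume "(u, w) \<in> parcs T"
    then have "is_cycle T [u, v, w]"
      using uvw V neq sym by (simp add: is_cycle_def vpath_def vwalk_conv_successively)
    then show False using acyclic by blast
  qed
  show "z = v" if z: "(u, z) \<in> parcs T" "(z, w) \<in> parcs T"
  proof (rule ccontr)
    assume "z \<noteq> v"
    moreover have "z \<noteq> u" "z \<noteq> w" using z pair_no_loops by fastforce+
    ultimately have "is_cycle T [u, v, w, z]"
      using uvw V neq z sym in_arcsD2[OF z(1)]
      by (simp add: is_cycle_def vpath_def vwalk_conv_successively)
    then show False using acyclic by blast
  qed
qed

section \<open>Interior vertices and leaves\<close>

lemma vpath_interior: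
  assumes "vpath p (with_proj G)" "v \<in> set p" "v \<noteq> hd p" "v \<noteq> last p"
  shows "v \<in> interior_verts G"
proof -
  obtain as bs where p: "p = as @ v # bs"
    using assms(2) by (auto simp: in_set_conv_decomp)
  have ne: "as \<noteq> []" "bs \<noteq> []" using p assms(3,4) by auto
  then have "(last as, v) \<in> parcs G" "(v, hd bs) \<in> parcs G"
    using assms(1) p
    by (auto simp: vpath_def vwalk_conv_successively successively_append_iff successively_Cons)
  \<comment> \<open>Distinctness of the path separates the predecessor of \<open>v\<close> from its
    successor.\<close>
  moreover have "set as \<inter> set bs = {}" using assms(1) p by (auto simp: vpath_def)
  then have "last as \<noteq> hd bs"
    using last_in_set[OF ne(1)] hd_in_set[OF ne(2)] by (metis disjoint_iff)
  ultimately show ?thesis by (auto simp: interior_verts_def)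
qed

text \<open>Each of the two vertices has the other as its only neighbour, so a walk cannot leave the
  pair.\<close>

lemma adjacent_leaves_vwalk:
  assumes "pair_graph G" "x \<notin> interior_verts G" "y \<notin> interior_verts G" "(x, y) \<in> parcs G"
    and "vwalk p (with_proj G)" "hd p \<in> {x, y}"
  shows "set p \<subseteq> {x, y}"
  using assms(5,6)
proof (induct p rule: vwalk_induct)
  case (Base u)
  then show ?case by simp
next
  case (Cons u v es)
  have "(y, x) \<in> parcs G" using assms(1,4) by (rule pair_graph_arc_sym)
  then have "v \<in> {x, y}"
    using Cons(1,3) assms(2-4) by (auto simp: interior_verts_def)
  then show ?case using Cons by simp
qed

text \<open>Otherwise the path is a single edge between two leaves; by connectedness these are all
  the vertices, against the bound of three.\<close>

lemma vpath_meets_interior: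
  assumes "pair_graph G" "connected (with_proj G)" "card (pverts G) \<ge> 3"
    and p: "vpath p (with_proj G)" "hd p \<noteq> last p"
  shows "set p \<inter> interior_verts G \<noteq> {}"
proof
  assume none: "set p \<inter> interior_verts G = {}"
  have "p \<noteq> []" using p(1) by auto
  obtain x q where xq: "p = x # q" using \<open>p \<noteq> []\<close> by (cases p) auto
  with p(2) obtain y r where pq: "p = x # y # r" by (cases q) auto
  have "y = last p"
    using vpath_interior[OF p(1), of y] none p(1) pq by (auto simp: vpath_def)
  have adj: "(x, y) \<in> parcs G"
    using p(1) pq by (simp add: vpath_def vwalk_conv_successively)
  have leaves: "x \<notin> interior_verts G" "y \<notin> interior_verts G" using none pq by auto
  have xV: "x \<in> pverts G" using p(1) pq by (simp add: vpath_def vwalk_def)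
  have "pverts G \<subseteq> {x, y}"
  proof
    fix z assume "z \<in> pverts G"
    with xV obtain s where s: "shortest_path G x s z"
      using ex_shortest_path[OF assms(1,2)] by blast
    then have "set s \<subseteq> {x, y}"
      using adjacent_leaves_vwalk[OF assms(1) leaves adj, of s]
      by (simp add: shortest_path_iff_vwalk)
    moreover have "z \<in> set s"
      using s by (auto simp: shortest_path_iff_vwalk)
    ultimately show "z \<in> {x, y}" by blast
  qed
  then have "card (pverts G) \<le> card {x, y}" by (intro card_mono) auto
  also have "\<dots> \<le> 2" by (simp add: card_insert_if)
  finally show False using assms(3) by simp
qed

text \<open>Any shortest path works, since all its vertices apart from the ends are
  interior.\<close>

lemma total_mutual_visibility_set_leaves:
  assumes "pair_graph G" "connected (with_proj G)"
  shows "total_mutual_visibility_set G (pverts G - interior_verts G)"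
proof -
  have "visible G (pverts G - interior_verts G) x y" if xy: "x \<in> pverts G" "y \<in> pverts G" for x y
  proof -
    obtain p where p: "shortest_path G x p y" using ex_shortest_path[OF assms xy] .
    then have "set p - {x, y} \<subseteq> interior_verts G"
      using vpath_interior[of p G] by (auto simp: shortest_path_def path_betw_def)
    then show ?thesis using p by (auto simp: visible_def)
  qed
  then show ?thesis by (auto simp: total_mutual_visibility_set_def)
qed

lemma mu_t_tree:
  assumes "is_tree T"
  shows "mu_t T = card (pverts T - interior_verts T)"
proof -
  have T: "pair_graph T" "connected (with_proj T)" using assms by (auto simp: is_tree_def)
  interpret pair_graph T by fact
  obtain X where X: "total_mutual_visibility_set T X" "card X = mu_t T"
    using mu_t_attained[OF T] .
  have "v \<notin> X" if v: "v \<in> interior_verts T" for v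
  proof -
    obtain u w where uvw: "(u, v) \<in> parcs T" "(v, w) \<in> parcs T" "u \<noteq> w"
      using v by (auto simp: interior_verts_def)
    show ?thesis
      by (rule total_mutual_visibility_set_not_in[OF T(1) X(1) uvw is_tree_path_two[OF assms uvw]])
  qed
  then have "X \<subseteq> pverts T - interior_verts T"
    using X(1) by (auto simp: total_mutual_visibility_set_def)
  then have "mu_t T \<le> card (pverts T - interior_verts T)"
    unfolding X(2)[symmetric] by (intro card_mono) (auto intro: pair_finite_verts)
  moreover have "card (pverts T - interior_verts T) \<le> mu_t T"
    using total_mutual_visibility_set_leaves[OF T] by (intro card_le_mu_t pair_finite_verts)
  ultimately show ?thesis by simp
qed

section \<open>Walks in the Cartesian product\<close>

lemma in_parcs_cart_prod:
  assumes "pair_graph G" "pair_graph H"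
  shows "((g, h), (g', h')) \<in> parcs (G \<box> H) \<longleftrightarrow>
    (g, g') \<in> parcs G \<and> h = h' \<and> h \<in> pverts H \<or> g = g' \<and> g \<in> pverts G \<and> (h, h') \<in> parcs H"
proof -
  interpret G: pair_graph G by fact
  interpret H: pair_graph H by fact
  show ?thesis
    using G.in_arcsD1 G.in_arcsD2 H.in_arcsD1 H.in_arcsD2 by (auto simp: cart_prod_def)
qed

lemma pverts_cart_prod: "pverts (G \<box> H) = pverts G \<times> pverts H"
  by (simp add: cart_prod_def)

lemma vwalk_cart_prod_fst:
  assumes "pair_graph G" "pair_graph H" "vwalk p (with_proj G)" "h \<in> pverts H"
  shows "vwalk (map (\<lambda>g. (g, h)) p) (with_proj (G \<box> H))"
  using assms(3,4)
  by (auto simp: vwalk_conv_successively successively_map pverts_cart_prod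
      in_parcs_cart_prod[OF assms(1,2)] elim!: successively_mono)

lemma vwalk_cart_prod_snd:
  assumes "pair_graph G" "pair_graph H" "g \<in> pverts G" "vwalk p (with_proj H)"
  shows "vwalk (map (Pair g) p) (with_proj (G \<box> H))"
  using assms(3,4)
  by (auto simp: vwalk_conv_successively successively_map pverts_cart_prod
      in_parcs_cart_prod[OF assms(1,2)] elim!: successively_mono)

text \<open>Each arc of the product moves exactly one coordinate, hence extends exactly one of the
  two projections. The summand 1 arises because the first vertex is counted in both.\<close>

lemma vwalk_cart_prod_projections:
  assumes "pair_graph G" "pair_graph H" "vwalk r (with_proj (G \<box> H))"
  obtains p q where
    "vwalk p (with_proj G)" "hd p = fst (hd r)" "last p = fst (last r)" "set p = fst ` set r"
    "vwalk q (with_proj H)" "hd q = snd (hd r)" "last q = snd (last r)" "set q = snd ` set r"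
    "length p + length q = length r + 1"
proof -
  have "\<exists>p q. vwalk p (with_proj G) \<and> hd p = fst (hd r) \<and> last p = fst (last r) \<and>
      set p = fst ` set r \<and>
      vwalk q (with_proj H) \<and> hd q = snd (hd r) \<and> last q = snd (last r) \<and>
      set q = snd ` set r \<and> length p + length q = length r + 1"
    using assms(3)
  proof (induct r rule: vwalk_induct)
    case (Base u)
    then show ?case
      by (intro exI[of _ "[fst u]"] exI[of _ "[snd u]"]) (auto simp: pverts_cart_prod)
  next
    case (Cons u v es)
    obtain p q where pq:
      "vwalk p (with_proj G)" "hd p = fst v" "last p = fst (last (v # es))"
      "set p = fst ` set (v # es)"
      "vwalk q (with_proj H)" "hd q = snd v" "last q = snd (last (v # es))"
      "set q = snd ` set (v # es)" "length p + length q = length (v # es) + 1"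
      using Cons(2) by auto
    have ne: "p \<noteq> []" "q \<noteq> []" using pq by auto
    have "(fst u, fst v) \<in> parcs G \<and> fst u \<in> pverts G \<and> snd u = snd v \<or>
          fst u = fst v \<and> (snd u, snd v) \<in> parcs H \<and> snd u \<in> pverts H"
      using Cons(1) by (auto simp: cart_prod_def)
    then show ?case
    proof
      assume a: "(fst u, fst v) \<in> parcs G \<and> fst u \<in> pverts G \<and> snd u = snd v"
      then have "vwalk (fst u # p) (with_proj G)"
        using pq(1,2) by (intro vwalk_consI) auto
      then show ?thesis
        using a pq ne by (intro exI[of _ "fst u # p"] exI[of _ q]) auto
    next
      assume a: "fst u = fst v \<and> (snd u, snd v) \<in> parcs H \<and> snd u \<in> pverts H"
      then have "vwalk (snd u # q) (with_proj H)"
        using pq(5,6) by (intro vwalk_consI) auto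
      then show ?thesis
        using a pq ne by (intro exI[of _ p] exI[of _ "snd u # q"]) auto
    qed
  qed
  then show ?thesis using that by blast
qed

text \<open>This is the lower bound in the additivity of distances, with vertices counted instead of
  arcs.\<close>

lemma shortest_path_cart_prod_length:
  assumes "pair_graph G" "pair_graph H"
    and "shortest_path G g p g'" "shortest_path H h q h'"
    and "vwalk r (with_proj (G \<box> H))" "hd r = (g, h)" "last r = (g', h')"
  shows "length p + length q \<le> length r + 1"
proof -
  obtain p' q' where
    "vwalk p' (with_proj G)" "hd p' = g" "last p' = g'"
    "vwalk q' (with_proj H)" "hd q' = h" "last q' = h'"
    and len: "length p' + length q' = length r + 1"
    using vwalk_cart_prod_projections[OF assms(1,2,5)] assms(6,7) by (metis fst_conv snd_conv)
  then have "length p \<le> length p'" "length q \<le> length q'"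
    using assms(3,4) by (auto simp: shortest_path_iff_vwalk)
  then show ?thesis using len by linarith
qed

text \<open>A walk of \<open>H\<close> lifted into the layer over \<open>g\<close> competes with
  \<open>r\<close>; comparing lengths leaves no room for a move in the direction of
  \<open>G\<close>.\<close>

lemma shortest_path_layer:
  assumes "pair_graph G" "pair_graph H" "g \<in> pverts G"
    and r: "shortest_path (G \<box> H) (g, h) r (g, h')"
  obtains q where "shortest_path H h q h'" "set r = Pair g ` set q"
proof -
  have r': "vwalk r (with_proj (G \<box> H))" "hd r = (g, h)" "last r = (g, h')"
    using r by (auto simp: shortest_path_iff_vwalk)
  obtain p q where pq:
    "vwalk p (with_proj G)" "hd p = g" "set p = fst ` set r"
    "vwalk q (with_proj H)" "hd q = h" "last q = h'" "set q = snd ` set r"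
    and len: "length p + length q = length r + 1"
    using vwalk_cart_prod_projections[OF assms(1,2) r'(1)] r'(2,3) by (metis fst_conv snd_conv)
  have lift: "length r \<le> length s" if s: "vwalk s (with_proj H)" "hd s = h" "last s = h'" for s
  proof -
    have "s \<noteq> []" using s(1) by auto
    then have "hd (map (Pair g) s) = (g, h)" "last (map (Pair g) s) = (g, h')"
      using s by (auto simp: hd_map last_map)
    then have "length r \<le> length (map (Pair g) s)"
      using r vwalk_cart_prod_snd[OF assms(1-3) s(1)] unfolding shortest_path_iff_vwalk by blast
    then show ?thesis by simp
  qed
  have "length p \<noteq> 0" using pq(1) by auto
  \<comment> \<open>Lifting \<open>q\<close> itself gives \<open>length r \<le> length q\<close>, so
    \<open>p\<close> has at most one vertex.\<close>
  then have "length p = 1" "length q \<le> length r"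
    using lift[OF pq(4-6)] len by linarith+
  then have "set p = {g}" using pq(2) by (auto simp: length_Suc_conv)
  then have "fst z = g" if "z \<in> set r" for z using that pq(3) by auto
  then have "set r = Pair g ` set q"
    unfolding pq(7) by (force simp: image_image)
  moreover have "shortest_path H h q h'"
    using pq(4-6) lift \<open>length q \<le> length r\<close>
    unfolding shortest_path_iff_vwalk by (meson order_trans)
  ultimately show ?thesis using that by blast
qed

section \<open>Total mutual-visibility sets of the product\<close>

lemma total_mutual_visibility_set_layer:
  assumes "pair_graph G" "pair_graph H" "g \<in> pverts G"
    and X: "total_mutual_visibility_set (G \<box> H) X"
  shows "total_mutual_visibility_set H {h. (g, h) \<in> X}"
proof -
  have "visible H {h. (g, h) \<in> X} h h'" if hh: "h \<in> pverts H" "h' \<in> pverts H" for h h'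
  proof -
    obtain r where r: "shortest_path (G \<box> H) (g, h) r (g, h')" "set r \<inter> X \<subseteq> {(g, h), (g, h')}"
      using total_mutual_visibility_setE[OF X, of "(g, h)" "(g, h')"] hh assms(3)
      by (auto simp: pverts_cart_prod)
    obtain q where "shortest_path H h q h'" "set r = Pair g ` set q"
      using shortest_path_layer[OF assms(1-3) r(1)] .
    \<comment> \<open>A selected vertex of \<open>q\<close> lifts to a vertex of \<open>r\<close> in
      \<open>X\<close>, hence to an end of \<open>r\<close>.\<close>
    then show ?thesis using r(2) unfolding visible_def by blast
  qed
  then show ?thesis
    using X by (auto simp: total_mutual_visibility_set_def pverts_cart_prod)
qed

text \<open>The route follows a shortest path of \<open>G\<close> at height \<open>h\<close> up to a
  vertex \<open>t\<close>, crosses to height \<open>h'\<close> over \<open>t\<close>, and then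
  completes the path of \<open>G\<close>. With \<open>t\<close> interior the crossing avoids the
  selected set; when \<open>g = g'\<close>, visibility in \<open>H\<close> suffices.\<close>

lemma total_mutual_visibility_set_leaves_times:
  assumes G: "pair_graph G" "connected (with_proj G)" "card (pverts G) \<ge> 3"
    and H: "pair_graph H" "connected (with_proj H)"
    and S: "total_mutual_visibility_set H S"
  shows "total_mutual_visibility_set (G \<box> H) ((pverts G - interior_verts G) \<times> S)"
    (is "total_mutual_visibility_set _ (?L \<times> S)")
proof -
  have "visible (G \<box> H) (?L \<times> S) (g, h) (g', h')"
    if V: "g \<in> pverts G" "g' \<in> pverts G" "h \<in> pverts H" "h' \<in> pverts H" for g g' h h'
  proof -
    obtain q where q: "shortest_path H h q h'" "set q \<inter> S \<subseteq> {h, h'}"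
      using total_mutual_visibility_setE[OF S V(3,4)] .
    obtain p where p: "shortest_path G g p g'"
      using ex_shortest_path[OF G(1,2) V(1,2)] .
    have vp: "vpath p (with_proj G)" "hd p = g" "last p = g'"
      using p by (auto simp: shortest_path_def path_betw_def)
    have vq: "vwalk q (with_proj H)" "hd q = h" "last q = h'"
      using q(1) by (auto simp: shortest_path_iff_vwalk)
    have ne: "p \<noteq> []" "q \<noteq> []" using vp vq by auto
    obtain t where t: "t \<in> set p" "t \<in> interior_verts G \<or> g = g'"
      using vpath_meets_interior[OF G vp(1)] vp hd_in_set[OF ne(1)] by auto
    obtain a b where p_eq: "p = a @ t # b" using t(1) by (auto simp: in_set_conv_decomp)
    \<comment> \<open>The crossing contributes both \<open>(t, h)\<close> and
      \<open>(t, h')\<close>, so \<open>a\<close> and \<open>b\<close> omit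
      \<open>t\<close>.\<close>
    define r where "r = map (\<lambda>g. (g, h)) a @ map (Pair t) q @ map (\<lambda>g. (g, h')) b"
    have r: "vwalk r (with_proj (G \<box> H))"
    proof -
      have "vwalk p (with_proj G)" using vp(1) by auto
      then have "vwalk (map (\<lambda>g. (g, h)) p) (with_proj (G \<box> H))"
          "vwalk (map (\<lambda>g. (g, h')) p) (with_proj (G \<box> H))"
        using vwalk_cart_prod_fst[OF G(1) H(1)] V by auto
      moreover have "t \<in> pverts G" using vp(1) t(1) by (auto simp: vpath_def vwalk_def)
      then have "vwalk (map (Pair t) q) (with_proj (G \<box> H))"
        using vwalk_cart_prod_snd[OF G(1) H(1) _ vq(1)] by auto
      ultimately show ?thesis
        using ne vq(2,3) unfolding r_def p_eq vwalk_conv_successively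
        by (auto simp: successively_append_iff successively_Cons hd_map last_map hd_append)
    qed
    have ends: "hd r = (g, h)" "last r = (g', h')"
      using vp(2,3) vq(2,3) ne unfolding r_def p_eq
      by (auto simp: hd_append last_append hd_map last_map split: if_splits)
    have len: "length r + 1 = length p + length q" by (simp add: r_def p_eq)
    have "shortest_path (G \<box> H) (g, h) r (g', h')"
      using r ends len shortest_path_cart_prod_length[OF G(1) H(1) p q(1)]
      unfolding shortest_path_iff_vwalk by fastforce
    moreover have "set r \<inter> (?L \<times> S) \<subseteq> {(g, h), (g', h')}"
    proof
      fix z assume z: "z \<in> set r \<inter> (?L \<times> S)"
      \<comment> \<open>A leaf on \<open>p\<close> can only be one of its ends.\<close>
      have leaf: "x = g \<or> x = g'" if "x \<in> set p" "x \<notin> interior_verts G" for x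
        using vpath_interior[OF vp(1) that(1)] that(2) vp by auto
      obtain x k where zx: "z = (x, k)" "x \<notin> interior_verts G" "k \<in> S"
        using z by auto
      have dist: "distinct (a @ t # b)" and ends_p: "hd (a @ t # b) = g" "last (a @ t # b) = g'"
        using vp p_eq by (auto simp: vpath_def)
      consider "x \<in> set a" "k = h" | "x = t" "k \<in> set q" | "x \<in> set b" "k = h'"
        using z zx(1) by (auto simp: r_def)
      then show "z \<in> {(g, h), (g', h')}"
      proof cases
        case 1
        \<comment> \<open>By distinctness \<open>x\<close> is not \<open>g'\<close>, so it is
          \<open>g\<close>, at the height \<open>h\<close> of the start; the third case is
          symmetric.\<close>
        have "g' \<in> set (t # b)" using ends_p(2) last_in_set[of "t # b"] by simp
        then show ?thesis using 1 leaf[of x] zx dist p_eq by auto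
      next
        case 2
        then have "g = g'" using t(2) zx(2) by auto
        \<comment> \<open>A path without repetitions whose ends coincide is a single vertex.\<close>
        then have "a = []" "b = []"
          using dist ends_p last_in_set[of b] by (cases a; force split: if_splits)+
        then show ?thesis using 2 ends_p q(2) zx by auto
      next
        case 3
        have "g \<in> set (a @ [t])" using ends_p(1) by (cases a) auto
        then show ?thesis using 3 leaf[of x] zx dist p_eq by auto
      qed
    qed
    ultimately show ?thesis by (auto simp: visible_def)
  qed
  then show ?thesis
    using S by (auto simp: total_mutual_visibility_set_def pverts_cart_prod)
qed

text \<open>Two neighbours \<open>u\<close>, \<open>w\<close> of \<open>v\<close> keep a unique
  common neighbour in the layer at \<open>h\<close>: after a move in \<open>H\<close>, a second move
  in \<open>H\<close> would give \<open>u = w\<close>, and a move in \<open>T\<close> would require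
  a loop of \<open>H\<close>.\<close>

lemma total_mutual_visibility_set_tree_prod_subset:
  assumes T: "is_tree T" and H: "pair_graph H"
    and X: "total_mutual_visibility_set (T \<box> H) X"
  shows "X \<subseteq> (pverts T - interior_verts T) \<times> pverts H"
proof -
  have G: "pair_graph T" using T by (simp add: is_tree_def)
  interpret H: pair_graph H by fact
  have "(v, h) \<notin> X" if v: "v \<in> interior_verts T" and h: "h \<in> pverts H" for v h
  proof -
    obtain u w where uvw: "(u, v) \<in> parcs T" "(v, w) \<in> parcs T" "u \<noteq> w"
      using v by (auto simp: interior_verts_def)
    note unique = is_tree_path_two[OF T uvw]
    have loop: "(k, k) \<notin> parcs H" for k using H.pair_no_loops by fastforce
    show ?thesis
    proof (rule total_mutual_visibility_set_not_in[OF pair_graph_cart_prod[OF G H] X])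
      fix z assume "((u, h), z) \<in> parcs (T \<box> H)" "(z, (w, h)) \<in> parcs (T \<box> H)"
      then show "z = (v, h)"
        using unique(2) uvw(3) loop
        by (cases z) (auto simp: in_parcs_cart_prod[OF G H])
    qed (use uvw h unique(1) in \<open>auto simp: in_parcs_cart_prod[OF G H]\<close>)
  qed
  then show ?thesis
    using X by (auto simp: total_mutual_visibility_set_def pverts_cart_prod)
qed

theorem theorem4p5:
  fixes T :: "'a pair_pre_digraph" and H :: "'b pair_pre_digraph"
  assumes "is_tree T" and "card (pverts T) \<ge> 3"
    and "pair_graph H" and "connected (with_proj H)" and "card (pverts H) \<ge> 2"
  shows "mu_t (T \<box> H) = mu_t T * mu_t H"
proof -
  have T: "pair_graph T" "connected (with_proj T)" using assms(1) by (auto simp: is_tree_def)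
  interpret T: pair_graph T by fact
  interpret H: pair_graph H by fact
  let ?L = "pverts T - interior_verts T"
  have finL: "finite ?L" by (simp add: T.pair_finite_verts)
  have fin: "finite (pverts (T \<box> H))" by (simp add: pverts_cart_prod)
  obtain S where S: "total_mutual_visibility_set H S" "card S = mu_t H"
    using mu_t_attained[OF assms(3,4)] .
  have "card (?L \<times> S) \<le> mu_t (T \<box> H)"
    using total_mutual_visibility_set_leaves_times[OF T assms(2,3,4) S(1)]
    by (intro card_le_mu_t fin)
  moreover have "mu_t (T \<box> H) \<le> card ?L * mu_t H"
  proof -
    have "card X \<le> card ?L * mu_t H" if X: "total_mutual_visibility_set (T \<box> H) X" for X
    proof -
      have sub: "X \<subseteq> ?L \<times> pverts H"
        by (rule total_mutual_visibility_set_tree_prod_subset[OF assms(1,3) X])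
      \<comment> \<open>Counting \<open>X\<close> by its fibres over the leaves reduces the bound to
        one layer at a time.\<close>
      then have "X = (SIGMA t:?L. {h. (t, h) \<in> X})" by auto
      moreover have "finite {h. (t, h) \<in> X}" for t
        using sub by (intro finite_subset[OF _ H.pair_finite_verts]) auto
      ultimately have "card X = (\<Sum>t\<in>?L. card {h. (t, h) \<in> X})"
        using finL card_SigmaI[of ?L "\<lambda>t. {h. (t, h) \<in> X}"] by simp
      also have "\<dots> \<le> card ?L * mu_t H"
        using total_mutual_visibility_set_layer[OF T(1) assms(3) _ X]
        by (intro sum_bounded_above[where K = "mu_t H", simplified]
            card_le_mu_t H.pair_finite_verts) auto
      finally show ?thesis .
    qed
    \<comment> \<open>This witness makes the family under \<open>Max\<close> nonempty, as
      \<open>Max_le_iff\<close> requires.\<close>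
    moreover have "total_mutual_visibility_set (T \<box> H) (?L \<times> S)"
      using total_mutual_visibility_set_leaves_times[OF T assms(2,3,4) S(1)] .
    ultimately show ?thesis
      unfolding mu_t_def[of "T \<box> H"] using finite_total_mutual_visibility_sets[OF fin]
      by (subst Max_le_iff) auto
  qed
  ultimately show ?thesis
    using S(2) by (simp add: mu_t_tree[OF assms(1)] card_cartesian_product)
qed

end
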